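(* There are positive constants $c$ and $n_0$ such that for every $n\geq n_0$ there exists a tree $T_n$ with $n$ vertices and maximum degree $\Delta(T_n)\leq \frac{cn}{\log(n)}$ such that in the Client-Waiter game on $K_n$, Waiter can prevent Client from claiming a red copy of $T_n$.
   Context: In the unbiased Client-Waiter game on $K_n$, the board is the edge set of the complete graph $K_n$. In each round Waiter offers Client two previously unclaimed edges; Client chooses one of them, which he keeps (colored red), and the other goes to Waiter (colored blue). If in the final round only one unclaimed edge remains, it goes to Client. Client wins if at the end his red graph contains a copy of $T_n$; otherwise Waiter wins. *)

theory Defs
  imports Complex_Main
begin

definition Kn_edges :: "nat \<Rightarrow> nat set set" where
  "Kn_edges n = {e. \<exists>u v. u < n \<and> v < n \<and> u \<noteq> v \<and> e = {u, v}}"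

definition adj :: "nat set set \<Rightarrow> nat \<Rightarrow> nat \<Rightarrow> bool" where
  "adj E u v \<longleftrightarrow> {u, v} \<in> E \<and> u \<noteq> v"

definition connected_on :: "nat set \<Rightarrow> nat set set \<Rightarrow> bool" where
  "connected_on V E \<longleftrightarrow> (\<forall>u\<in>V. \<forall>v\<in>V. (adj E)\<^sup>*\<^sup>* u v)"

text \<open>Acyclic: no edge {u,v} whose endpoints are still joined by a path avoiding it
  (i.e. no edge lies on a cycle).\<close>
definition acyclic_graph :: "nat set set \<Rightarrow> bool" where
  "acyclic_graph E \<longleftrightarrow> \<not> (\<exists>u v. adj E u v \<and> (adj (E - {{u, v}}))\<^sup>*\<^sup>* u v)"

definition is_tree :: "nat \<Rightarrow> nat set set \<Rightarrow> bool" where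
  "is_tree n E \<longleftrightarrow> n \<ge> 1 \<and> E \<subseteq> Kn_edges n \<and> connected_on {0..<n} E \<and> acyclic_graph E"

definition degree :: "nat set set \<Rightarrow> nat \<Rightarrow> nat" where
  "degree E v = card {e \<in> E. v \<in> e}"

definition contains_copy :: "nat \<Rightarrow> nat set set \<Rightarrow> nat set set \<Rightarrow> bool" where
  "contains_copy n T R \<longleftrightarrow>
     (\<exists>f. inj_on f {0..<n} \<and> f ` {0..<n} \<subseteq> {0..<n} \<and> (\<forall>e\<in>T. f ` e \<in> R))"

text \<open>Waiter has a winning strategy from the position where Client owns the red edge set R
  and U is the set of unclaimed edges (Waiter's blue edges are irrelevant to the outcome).
  In each round Waiter offers two distinct unclaimed edges and Client keeps one of them;
  a single remaining edge goes to Client. Finite game, so the least fixed point captures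
  exactly Waiter's winning positions.\<close>
inductive waiter_wins_from :: "nat \<Rightarrow> nat set set \<Rightarrow> nat set set \<Rightarrow> nat set set \<Rightarrow> bool"
  for n :: nat and T :: "nat set set" where
  empty: "U = {} \<Longrightarrow> \<not> contains_copy n T R \<Longrightarrow> waiter_wins_from n T R U"
| single: "U = {e} \<Longrightarrow> \<not> contains_copy n T (insert e R) \<Longrightarrow> waiter_wins_from n T R U"
| offer: "e \<in> U \<Longrightarrow> f \<in> U \<Longrightarrow> e \<noteq> f \<Longrightarrow>
          waiter_wins_from n T (insert e R) (U - {e, f}) \<Longrightarrow>
          waiter_wins_from n T (insert f R) (U - {e, f}) \<Longrightarrow>
          waiter_wins_from n T R U"

definition waiter_wins_CW :: "nat \<Rightarrow> nat set set \<Rightarrow> bool" where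
  "waiter_wins_CW n T \<longleftrightarrow> waiter_wins_from n T {} (Kn_edges n)"

end

theory Submission
  imports Defs "HOL-Real_Asymp.Real_Asymp"
begin

text \<open>
  The tree is the initial segment of the \<open>m\<close>-ary tree in which \<open>v\<close> has parent \<open>v div m\<close>,
  where \<open>m\<close> is about \<open>n / k\<close> and \<open>k = \<lfloor>ln n / 4\<rfloor>\<close>. All its vertices outside \<open>{0..<k}\<close> have their
  parent in \<open>{0..<k}\<close>, so Waiter only has to ensure that for every set \<open>S\<close> of \<open>k\<close> vertices
  some vertex outside \<open>S\<close> has no red edge to \<open>S\<close>. The expected number of sets \<open>S\<close> violating this
  under random colouring of the free edges starts at
  \<open>(n choose k) * (1 - 2^-k)^(n - k) \<le> exp (- n^(3/4) / 3)\<close> for large \<open>n\<close>.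

  When \<open>e\<close> becomes red and \<open>f\<close> blue, this potential changes by at most
  \<open>A e - A f + B e f\<close>, where \<open>A\<close> ranges over \<open>[0, pot]\<close> and the correction \<open>B\<close>, caused by
  sets \<open>S\<close> for which \<open>e\<close> and \<open>f\<close> join the same outside vertex to \<open>S\<close>, has total at most
  \<open>2 n pot\<close> over all pairs. Grouping the \<open>M\<close> free edges into about \<open>M / sqrt n\<close> classes of similar
  \<open>A\<close> and averaging \<open>B\<close> over the pairs inside classes yields an offer for which the potential grows
  by a factor at most \<open>1 + O(sqrt n / M)\<close> whichever edge Client takes. Over the whole game this
  accumulates to only \<open>exp (O(sqrt n ln n))\<close>, hence the potential ends below 1.
\<close>

section \<open>Inequalities and averaging behind the choice of an offer\<close>

text \<open>At most one factor exceeds 1 and at most one lies below 1, so expanding leaves at most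
  the cross term \<open>x p * x q\<close>, which is not positive.\<close>

lemma prod_one_plus_le_one_plus_sum:
  fixes x :: "'j \<Rightarrow> real"
  assumes "finite J"
    and pos: "\<And>j. j \<in> J \<Longrightarrow> x j > 0 \<Longrightarrow> j = p"
    and neg: "\<And>j. j \<in> J \<Longrightarrow> x j < 0 \<Longrightarrow> j = q"
  shows "(\<Prod>j\<in>J. 1 + x j) \<le> 1 + (\<Sum>j\<in>J. x j)"
proof -
  have zero: "x j = 0" if "j \<in> J - J \<inter> {p, q}" for j
    using pos[of j] neg[of j] that by force
  have prod_eq: "(\<Prod>j\<in>J. 1 + x j) = (\<Prod>j\<in>J \<inter> {p, q}. 1 + x j)"
    by (rule prod.mono_neutral_right) (use zero assms(1) in auto)
  have sum_eq: "(\<Sum>j\<in>J. x j) = (\<Sum>j\<in>J \<inter> {p, q}. x j)"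
    by (rule sum.mono_neutral_right) (use zero assms(1) in auto)
  consider "p \<in> J" "q \<in> J" "p \<noteq> q" | "J \<inter> {p, q} = {}" | r where "J \<inter> {p, q} = {r}"
    by fastforce
  then show ?thesis
  proof cases
    case 1
    then have "J \<inter> {p, q} = {p, q}" by auto
    moreover have "x p \<ge> 0" "x q \<le> 0" using pos[of q] neg[of p] 1 by force+
    then have "x p * x q \<le> 0" by (rule mult_nonneg_nonpos)
    ultimately show ?thesis
      unfolding prod_eq sum_eq using 1 by (simp add: algebra_simps)
  qed (unfold prod_eq sum_eq, auto)
qed

text \<open>Convexity in tangent form: each class size \<open>m\<close> satisfies
  \<open>m\<^sup>2 \<ge> 2 * L * m - L\<^sup>2\<close>. Summing over \<open>K + 1\<close> labels,
  \<open>KL\<close> absorbs the \<open>L\<^sup>2\<close> terms; removing the diagonal turns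
  \<open>L\<close> into \<open>L - 1\<close>.\<close>

lemma card_equal_label_pairs_ge:
  fixes b :: "'a \<Rightarrow> nat"
  assumes "finite U" and "\<And>e. e \<in> U \<Longrightarrow> b e \<le> K" and KL: "(K + 1) * L \<le> card U"
  shows "real ((L - 1) * card U) \<le> real (card {(e, f) \<in> U \<times> U. e \<noteq> f \<and> b e = b f})"
proof -
  define m where "m j = card {e \<in> U. b e = j}" for j
  define Q where "Q = {(e, f) \<in> U \<times> U. e \<noteq> f \<and> b e = b f}"
  have sum_m: "(\<Sum>j\<le>K. m j) = card U"
  proof -
    have "card U = card (\<Union>j\<le>K. {e \<in> U. b e = j})"
      using assms(2) by (intro arg_cong[of _ _ card]) auto
    also have "\<dots> = (\<Sum>j\<le>K. m j)"
      unfolding m_def by (rule card_UN_disjoint) (use assms(1) in auto)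
    finally show ?thesis by simp
  qed
  have sum_m2: "(\<Sum>j\<le>K. m j * m j) = card Q + card U"
  proof -
    have "(\<Sum>j\<le>K. m j * m j) = (\<Sum>j\<le>K. card ({e \<in> U. b e = j} \<times> {e \<in> U. b e = j}))"
      unfolding m_def by (simp only: card_cartesian_product)
    also have "\<dots> = card (\<Union>j\<le>K. {e \<in> U. b e = j} \<times> {e \<in> U. b e = j})"
      by (rule card_UN_disjoint[symmetric]) (use assms(1) in auto)
    also have "(\<Union>j\<le>K. {e \<in> U. b e = j} \<times> {e \<in> U. b e = j}) = Q \<union> (\<lambda>e. (e, e)) ` U"
      using assms(2) by (auto simp: Q_def)
    also have "card \<dots> = card Q + card ((\<lambda>e. (e, e)) ` U)"
    proof (rule card_Un_disjoint)
      show "finite Q"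
        by (rule finite_subset[of _ "U \<times> U"]) (use assms(1) in \<open>auto simp: Q_def\<close>)
    qed (use assms(1) in \<open>auto simp: Q_def\<close>)
    also have "card ((\<lambda>e. (e, e)) ` U) = card U"
      by (rule card_image) (auto simp: inj_on_def)
    finally show ?thesis .
  qed
  have square: "2 * real L * real (m j) - real L * real L \<le> real (m j) * real (m j)" for j
    using zero_le_square[of "real (m j) - real L"] by (simp add: algebra_simps)
  have "2 * real L * real (card U) - real (K + 1) * (real L * real L)
      = (\<Sum>j\<le>K. 2 * real L * real (m j) - real L * real L)"
    unfolding sum_subtractf sum_distrib_left[symmetric] sum_m[symmetric] by simp
  also have "\<dots> \<le> (\<Sum>j\<le>K. real (m j) * real (m j))"
    by (rule sum_mono) (rule square)
  also have "\<dots> = real (\<Sum>j\<le>K. m j * m j)" by simp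
  also have "\<dots> = real (card Q) + real (card U)" unfolding sum_m2 by simp
  finally have *: "2 * real L * real (card U) - real (K + 1) * (real L * real L)
      \<le> real (card Q) + real (card U)" .
  have "real (K + 1) * real L \<le> real (card U)"
    using KL by (metis of_nat_le_iff of_nat_mult)
  then have "real (K + 1) * real L * real L \<le> real (card U) * real L"
    by (rule mult_right_mono) simp
  with * have "real L * real (card U) - real (card U) \<le> real (card Q)"
    by (simp add: algebra_simps)
  then show ?thesis
    unfolding Q_def[symmetric] by (cases L) (auto simp: algebra_simps)
qed

text \<open>Cut \<open>[0, p]\<close> into about \<open>card U / s\<close> slices. At least
  \<open>s * card U\<close> ordered pairs share a slice, so on some such pair \<open>B\<close> is at
  most \<open>2 * s * p / card U\<close>; the slice width has the same order, which is why the total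
  of \<open>B\<close> is measured by \<open>s\<^sup>2\<close>.\<close>

lemma close_pair_exists:
  fixes A :: "'a \<Rightarrow> real" and B :: "'a \<Rightarrow> 'a \<Rightarrow> real"
  assumes fin: "finite U" and s: "s \<ge> 1" and large: "card U \<ge> 4 * (s + 1)"
    and A: "\<And>e. e \<in> U \<Longrightarrow> 0 \<le> A e \<and> A e \<le> p" and p: "p \<ge> 0"
    and B: "\<And>e f. e \<in> U \<Longrightarrow> f \<in> U \<Longrightarrow> B e f \<ge> 0"
    and sum_B: "(\<Sum>e\<in>U. \<Sum>f\<in>U. B e f) \<le> 2 * real (s\<^sup>2) * p"
  shows "\<exists>e\<in>U. \<exists>f\<in>U. e \<noteq> f \<and> \<bar>A e - A f\<bar> + B e f \<le> p * (8 * real s / real (card U))"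
proof -
  define M where "M = card U"
  \<comment> \<open>\<open>L - 1 = s\<close> makes the pair count \<open>s * M\<close>;
    \<open>K + 1\<close> is the largest number of labels with
    \<open>(K + 1) * L \<le> M\<close>.\<close>
  define L where "L = s + 1"
  define K where "K = M div L - 1"
  have L: "L > 0" "L - 1 = s" by (auto simp: L_def)
  have "4 \<le> M div L"
    using large L by (simp add: M_def L_def less_eq_div_iff_mult_less_eq)
  then have K3: "K \<ge> 3" and KM: "K + 1 = M div L" by (auto simp: K_def)
  have M: "M > 0" using large by (simp add: M_def)
  have KL: "(K + 1) * L \<le> M" unfolding KM by (simp add: div_times_less_eq_dividend)
  have "M < (K + 2) * L"
    using dividend_less_div_times[of L M] L KM by (simp add: algebra_simps)
  also have "(K + 2) * L \<le> (2 * K) * L" using K3 by (intro mult_right_mono) auto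
  finally have MKL: "M \<le> 2 * K * L" by simp
  \<comment> \<open>The value \<open>p\<close> itself gets label \<open>K\<close>, hence
    \<open>K + 1\<close> labels. For \<open>p = 0\<close> division by zero makes every label
    0.\<close>
  define b where "b e = nat \<lfloor>A e * real K / p\<rfloor>" for e
  have bK: "b e \<le> K" if "e \<in> U" for e
  proof -
    have "A e * real K / p \<le> real K"
      using A[OF that] p
      by (cases "p = 0") (auto simp: divide_le_eq mult.commute[of "real K"] intro: mult_right_mono)
    then show ?thesis unfolding b_def by linarith
  qed
  have same: "\<bar>A e - A f\<bar> \<le> p / real K" if "e \<in> U" "f \<in> U" "b e = b f" for e f
  proof (cases "p = 0")
    case True
    then show ?thesis using A[OF that(1)] A[OF that(2)] by auto
  next
    case False
    then have "p > 0" using p by simp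
    have nonneg: "A e * real K / p \<ge> 0" "A f * real K / p \<ge> 0"
      using A[OF that(1)] A[OF that(2)] p by auto
    then have "\<lfloor>A e * real K / p\<rfloor> = \<lfloor>A f * real K / p\<rfloor>"
      using that(3) unfolding b_def by (metis eq_nat_nat_iff zero_le_floor)
    then have "\<bar>A e * real K / p - A f * real K / p\<bar> \<le> 1" by linarith
    then have "\<bar>A e - A f\<bar> * (real K / p) \<le> 1"
      using \<open>p > 0\<close> K3 by (simp add: abs_mult abs_divide flip: left_diff_distrib diff_divide_distrib)
    then show ?thesis using \<open>p > 0\<close> K3 by (simp add: field_simps)
  qed
  define Q where "Q = {(e, f) \<in> U \<times> U. e \<noteq> f \<and> b e = b f}"
  have finQ: "finite Q" and QU: "Q \<subseteq> U \<times> U"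
    by (auto simp: Q_def intro: finite_subset[of _ "U \<times> U"] fin)
  have cardQ: "real s * real M \<le> real (card Q)"
    using card_equal_label_pairs_ge[of U b K L] fin bK KL L unfolding Q_def M_def by auto
  have "\<exists>z\<in>Q. B (fst z) (snd z) \<le> 2 * real s * p / real M"
  proof (rule ccontr)
    assume "\<not> ?thesis"
    then have big: "\<And>z. z \<in> Q \<Longrightarrow> 2 * real s * p / real M < B (fst z) (snd z)" by force
    have "real s * real M > 0" using s M by simp
    then have "Q \<noteq> {}" using cardQ by auto
    have "2 * real (s\<^sup>2) * p = real s * real M * (2 * real s * p / real M)"
      using M by (simp add: power2_eq_square)
    also have "\<dots> \<le> real (card Q) * (2 * real s * p / real M)"
      by (rule mult_right_mono[OF cardQ]) (use p in auto)
    also have "\<dots> = (\<Sum>z\<in>Q. 2 * real s * p / real M)" by simp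
    also have "\<dots> < (\<Sum>z\<in>Q. B (fst z) (snd z))"
      by (rule sum_strict_mono) (use finQ \<open>Q \<noteq> {}\<close> big in auto)
    also have "\<dots> \<le> (\<Sum>z\<in>U \<times> U. B (fst z) (snd z))"
      by (rule sum_mono2) (use QU fin B in auto)
    also have "\<dots> = (\<Sum>e\<in>U. \<Sum>f\<in>U. B e f)"
      by (simp add: sum.cartesian_product case_prod_beta)
    finally show False using sum_B by simp
  qed
  then obtain e f where ef: "(e, f) \<in> Q" "B e f \<le> 2 * real s * p / real M" by auto
  \<comment> \<open>The slice width is compared with \<open>M\<close> through
    \<open>M \<le> 2 * K * L\<close> and \<open>L \<le> 2 * s\<close>.\<close>
  have "p / real K \<le> p * (4 * real s / real M)"
  proof -
    have "real M \<le> 2 * real K * real L" using MKL by (metis of_nat_le_iff of_nat_mult of_nat_numeral)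
    also have "\<dots> \<le> 2 * real K * (2 * real s)"
      using s by (intro mult_left_mono) (auto simp: L_def)
    finally have "1 / real K \<le> 4 * real s / real M" using K3 M by (simp add: field_simps)
    from mult_left_mono[OF this p] show ?thesis by simp
  qed
  moreover have "2 * real s * p / real M \<le> p * (4 * real s / real M)"
    using p M by (simp add: field_simps)
  moreover have "p * (8 * real s / real M) = p * (4 * real s / real M) + p * (4 * real s / real M)"
    by (simp add: field_simps)
  ultimately have "\<bar>A e - A f\<bar> + B e f \<le> p * (8 * real s / real M)"
    using same[of e f] ef by (auto simp: Q_def)
  then show ?thesis using ef unfolding Q_def M_def by blast
qed

text \<open>This caps by 2 the total interaction inside one block with \<open>d\<close> free edges,
  which is \<open>d\<^sup>2 / (2 ^ d - 1)\<close>.\<close>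

lemma square_le_two_power: "(real d)\<^sup>2 \<le> 2 * 2 ^ d - 2"
proof (induction d rule: nat_less_induct)
  case (1 d)
  show ?case
  proof (cases "d \<le> 3")
    case True
    then have "d \<in> {0, 1, 2, 3}" by auto
    then show ?thesis by auto
  next
    case False
    define c where "c = d - 1"
    have d: "d = Suc c" and c: "c \<ge> 3" using False by (auto simp: c_def)
    have "(real c)\<^sup>2 \<le> 2 * 2 ^ c - 2" using 1 d by simp
    moreover have "3 * real c \<le> (real c)\<^sup>2"
      using c by (simp add: power2_eq_square)
    moreover have "real c \<ge> 3" using c by simp
    ultimately have "(real c)\<^sup>2 + 2 * real c + 1 \<le> 4 * 2 ^ c - 2" by linarith
    then show ?thesis by (simp add: d power2_eq_square algebra_simps)
  qed
qed

section \<open>The potential and its change in one round\<close>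

text \<open>Waiter's goal is that for every \<open>i\<close> some block \<open>P i j\<close> ends up without a red edge.
  The potential is the expected number of \<open>i\<close> for which this fails when each free edge is
  coloured by a fair coin.\<close>

locale block_game =
  fixes I :: "'i set" and J :: "'i \<Rightarrow> 'j set" and P :: "'i \<Rightarrow> 'j \<Rightarrow> 'a set" and s :: nat
  assumes finite_I: "finite I"
    and finite_J: "i \<in> I \<Longrightarrow> finite (J i)"
    and card_J: "i \<in> I \<Longrightarrow> card (J i) \<le> s\<^sup>2"
    and s_pos: "s \<ge> 1"
    and disjoint: "i \<in> I \<Longrightarrow> j \<in> J i \<Longrightarrow> j' \<in> J i \<Longrightarrow> x \<in> P i j \<Longrightarrow> x \<in> P i j' \<Longrightarrow> j = j'"
begin

text \<open>Probability that the block ends with a red edge; it is 0 once the block has neither a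
  red nor a free edge.\<close>

definition block_prob :: "'a set \<Rightarrow> 'a set \<Rightarrow> 'i \<Rightarrow> 'j \<Rightarrow> real" where
  "block_prob R U i j = (if P i j \<inter> R = {} then 1 - (1/2) ^ card (P i j \<inter> U) else 1)"

text \<open>The relative change of \<^const>\<open>block_prob\<close> when an edge of the block is coloured:
  plus for red, minus for blue.\<close>

definition gain :: "'a set \<Rightarrow> 'a set \<Rightarrow> 'i \<Rightarrow> 'j \<Rightarrow> real" where
  "gain R U i j = (if P i j \<inter> R = {} then 1 / (2 ^ card (P i j \<inter> U) - 1) else 0)"

text \<open>Blocks of one \<open>i\<close> are disjoint, so their events are independent and the
  probabilities multiply.\<close>

definition prob :: "'a set \<Rightarrow> 'a set \<Rightarrow> 'i \<Rightarrow> real" where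
  "prob R U i = (\<Prod>j\<in>J i. block_prob R U i j)"

definition pot :: "'a set \<Rightarrow> 'a set \<Rightarrow> real" where
  "pot R U = (\<Sum>i\<in>I. prob R U i)"

text \<open>The quantity \<open>A\<close> of the sketch: the first-order increase of
  \<open>pot\<close> when \<open>e\<close> turns red, and the decrease when it turns blue.\<close>

definition influence :: "'a set \<Rightarrow> 'a set \<Rightarrow> 'a \<Rightarrow> real" where
  "influence R U e = (\<Sum>i\<in>I. prob R U i * (\<Sum>j\<in>J i. gain R U i j * of_bool (e \<in> P i j)))"

text \<open>The quantity \<open>B\<close> of the sketch: it restores the blue loss wrongly charged
  to blocks containing both edges.\<close>

definition interaction :: "'a set \<Rightarrow> 'a set \<Rightarrow> 'a \<Rightarrow> 'a \<Rightarrow> real" where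
  "interaction R U e f =
    (\<Sum>i\<in>I. prob R U i * (\<Sum>j\<in>J i. gain R U i j * of_bool (e \<in> P i j) * of_bool (f \<in> P i j)))"

lemma block_prob_nonneg: "block_prob R U i j \<ge> 0"
  by (simp add: block_prob_def power_le_one)

lemma gain_nonneg: "gain R U i j \<ge> 0"
  by (simp add: gain_def)

lemma prob_nonneg: "prob R U i \<ge> 0"
  unfolding prob_def by (intro prod_nonneg block_prob_nonneg)

lemma pot_nonneg: "pot R U \<ge> 0"
  unfolding pot_def by (intro sum_nonneg prob_nonneg)

lemma gain_le_one:
  assumes "finite U" "e \<in> U" "e \<in> P i j"
  shows "gain R U i j \<le> 1"
proof -
  define d where "d = card (P i j \<inter> U)"
  have "d \<noteq> 0" using assms by (auto simp: d_def)
  then have "(2::real) ^ 1 \<le> 2 ^ d" by (intro power_increasing) auto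
  then show ?thesis unfolding gain_def d_def[symmetric] by simp
qed

text \<open>Red turns the factor \<open>1 - (1/2) ^ d\<close> into 1, blue halves the exponential's
  denominator; both change it by the same relative amount \<open>1 / (2 ^ d - 1)\<close>. If both
  edges lie in the block, red decides and the product term cancels the blue loss.\<close>

lemma block_prob_update:
  assumes "finite U" "e \<in> U" "f \<in> U"
  shows "block_prob (insert e R) (U - {e, f}) i j = block_prob R U i j *
    (1 + gain R U i j * (of_bool (e \<in> P i j) - of_bool (f \<in> P i j)
                         + of_bool (e \<in> P i j) * of_bool (f \<in> P i j)))"
proof -
  define D where "D = P i j"
  define d where "d = card (D \<inter> U)"
  \<comment> \<open>A block touched by the offer has \<open>d > 0\<close>, so
    \<open>2 ^ d - 1\<close> is not zero.\<close>
  have pow: "(2::real) ^ d > 1" if "e \<in> D \<or> f \<in> D"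
  proof -
    have "d \<noteq> 0" using assms that by (auto simp: d_def)
    then show ?thesis by simp
  qed
  consider "D \<inter> R \<noteq> {}" | "D \<inter> R = {}" "e \<in> D"
    | "D \<inter> R = {}" "e \<notin> D" "f \<in> D" | "D \<inter> R = {}" "e \<notin> D" "f \<notin> D" by blast
  then show ?thesis
  proof cases
    case 1
    then show ?thesis by (auto simp: block_prob_def gain_def D_def)
  next
    case 2
    then have "P i j \<inter> insert e R \<noteq> {}" by (auto simp: D_def)
    then show ?thesis
      using 2 pow unfolding block_prob_def gain_def D_def[symmetric] d_def[symmetric]
      by (simp add: field_simps)
  next
    case 3
    have "D \<inter> (U - {e, f}) = D \<inter> U - {f}" using 3 by auto
    then have "card (D \<inter> (U - {e, f})) = d - 1" using 3 assms by (simp add: d_def)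
    moreover have "d > 0" using 3 assms by (auto simp: d_def card_gt_0_iff)
    ultimately have half: "(1/2::real) ^ card (D \<inter> (U - {e, f})) = 2 / 2 ^ d"
      by (cases d) (auto simp: field_simps)
    show ?thesis
      using 3 pow unfolding block_prob_def gain_def D_def[symmetric] half d_def[symmetric]
      by (simp add: field_simps)
  next
    case 4
    have "D \<inter> (U - {e, f}) = D \<inter> U" using 4 by auto
    then show ?thesis using 4 unfolding block_prob_def gain_def D_def[symmetric] by simp
  qed
qed

lemma prob_update:
  assumes "finite U" "e \<in> U" "f \<in> U" and i: "i \<in> I"
  shows "prob (insert e R) (U - {e, f}) i \<le> prob R U i * (1
    + (\<Sum>j\<in>J i. gain R U i j * of_bool (e \<in> P i j))
    - (\<Sum>j\<in>J i. gain R U i j * of_bool (f \<in> P i j))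
    + (\<Sum>j\<in>J i. gain R U i j * of_bool (e \<in> P i j) * of_bool (f \<in> P i j)))"
proof -
  define x where "x j = gain R U i j * (of_bool (e \<in> P i j) - of_bool (f \<in> P i j)
                         + of_bool (e \<in> P i j) * of_bool (f \<in> P i j))" for j
  \<comment> \<open>If no block of \<open>i\<close> contains \<open>e\<close>, then \<open>p\<close>
    is arbitrary; likewise \<open>q\<close> for \<open>f\<close>.\<close>
  obtain p where p: "\<And>j. j \<in> J i \<Longrightarrow> e \<in> P i j \<Longrightarrow> j = p" using disjoint[OF i] by metis
  obtain q where q: "\<And>j. j \<in> J i \<Longrightarrow> f \<in> P i j \<Longrightarrow> j = q" using disjoint[OF i] by metis
  have "(\<Prod>j\<in>J i. 1 + x j) \<le> 1 + (\<Sum>j\<in>J i. x j)"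
  proof (rule prod_one_plus_le_one_plus_sum)
    show "j = p" if "j \<in> J i" "x j > 0" for j
      using that p gain_nonneg[of R U i j]
      by (cases "e \<in> P i j"; cases "f \<in> P i j") (auto simp: x_def)
    show "j = q" if "j \<in> J i" "x j < 0" for j
      using that q gain_nonneg[of R U i j]
      by (cases "e \<in> P i j"; cases "f \<in> P i j") (auto simp: x_def)
  qed (use finite_J i in auto)
  moreover have "prob (insert e R) (U - {e, f}) i = prob R U i * (\<Prod>j\<in>J i. 1 + x j)"
    unfolding prob_def prod.distrib[symmetric] x_def
    by (intro prod.cong refl block_prob_update assms)
  moreover have "(\<Sum>j\<in>J i. x j) = (\<Sum>j\<in>J i. gain R U i j * of_bool (e \<in> P i j))
    - (\<Sum>j\<in>J i. gain R U i j * of_bool (f \<in> P i j))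
    + (\<Sum>j\<in>J i. gain R U i j * of_bool (e \<in> P i j) * of_bool (f \<in> P i j))"
    unfolding sum_subtractf[symmetric] sum.distrib[symmetric] x_def
    by (intro sum.cong refl) (simp add: algebra_simps)
  ultimately show ?thesis
    using mult_left_mono[OF _ prob_nonneg[of R U i], of "\<Prod>j\<in>J i. 1 + x j" "1 + (\<Sum>j\<in>J i. x j)"]
    by (simp only: add_diff_eq add.assoc[symmetric])
qed

lemma pot_update:
  assumes "finite U" "e \<in> U" "f \<in> U"
  shows "pot (insert e R) (U - {e, f})
    \<le> pot R U + influence R U e - influence R U f + interaction R U e f"
proof -
  have "pot (insert e R) (U - {e, f}) \<le> (\<Sum>i\<in>I. prob R U i * (1
    + (\<Sum>j\<in>J i. gain R U i j * of_bool (e \<in> P i j))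
    - (\<Sum>j\<in>J i. gain R U i j * of_bool (f \<in> P i j))
    + (\<Sum>j\<in>J i. gain R U i j * of_bool (e \<in> P i j) * of_bool (f \<in> P i j))))"
    unfolding pot_def by (intro sum_mono prob_update assms)
  also have "\<dots> = pot R U + influence R U e - influence R U f + interaction R U e f"
    unfolding pot_def influence_def interaction_def
      sum_subtractf[symmetric] sum.distrib[symmetric]
    by (intro sum.cong refl) (simp only: distrib_left right_diff_distrib mult_1_right)
  finally show ?thesis .
qed

lemma influence_nonneg: "influence R U e \<ge> 0"
  unfolding influence_def
  by (intro sum_nonneg mult_nonneg_nonneg prob_nonneg gain_nonneg) auto

lemma interaction_nonneg: "interaction R U e f \<ge> 0"
  unfolding interaction_def
  by (intro sum_nonneg mult_nonneg_nonneg prob_nonneg gain_nonneg) auto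

lemma interaction_commute: "interaction R U e f = interaction R U f e"
  unfolding interaction_def by (simp add: mult.assoc mult.commute[of "of_bool (e \<in> _)"])

lemma interaction_le_influence: "interaction R U e f \<le> influence R U f"
  unfolding interaction_def influence_def
  by (intro sum_mono mult_left_mono prob_nonneg) (auto simp: gain_nonneg)

text \<open>For each \<open>i\<close> the edge lies in at most one block, whose gain is at most
  1.\<close>

lemma influence_le_pot:
  assumes "finite U" "e \<in> U"
  shows "influence R U e \<le> pot R U"
  unfolding influence_def pot_def
proof (rule sum_mono)
  fix i assume i: "i \<in> I"
  obtain p where p: "\<And>j. j \<in> J i \<Longrightarrow> e \<in> P i j \<Longrightarrow> j = p" using disjoint[OF i] by metis
  have "(\<Sum>j\<in>J i. gain R U i j * of_bool (e \<in> P i j)) \<le> (\<Sum>j\<in>J i. of_bool (j = p))"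
  proof (rule sum_mono)
    fix j assume "j \<in> J i"
    then show "gain R U i j * of_bool (e \<in> P i j) \<le> of_bool (j = p)"
      using p[of j] gain_le_one[OF assms, of i j R] by (cases "e \<in> P i j") auto
  qed
  also have "\<dots> \<le> 1" using finite_J[OF i] by (simp add: of_bool_def sum.delta)
  finally show "prob R U i * (\<Sum>j\<in>J i. gain R U i j * of_bool (e \<in> P i j)) \<le> prob R U i"
    using mult_left_mono[OF _ prob_nonneg[of R U i]] by fastforce
qed

text \<open>Each of the at most \<open>s\<^sup>2\<close> blocks of \<open>i\<close> contributes at
  most 2, by \<open>square_le_two_power\<close>.\<close>

lemma sum_interaction_le:
  assumes "finite U"
  shows "(\<Sum>e\<in>U. \<Sum>f\<in>U. interaction R U e f) \<le> 2 * real (s\<^sup>2) * pot R U"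
proof -
  have block: "(\<Sum>e\<in>U. \<Sum>f\<in>U. gain R U i j * of_bool (e \<in> P i j) * of_bool (f \<in> P i j)) \<le> 2" for i j
  proof -
    define d where "d = card (P i j \<inter> U)"
    have d: "(\<Sum>e\<in>U. of_bool (e \<in> P i j)) = real d"
      using assms by (simp add: d_def Int_commute of_bool_def sum.If_cases)
    have "(\<Sum>e\<in>U. \<Sum>f\<in>U. gain R U i j * of_bool (e \<in> P i j) * of_bool (f \<in> P i j))
        = gain R U i j * (real d)\<^sup>2"
      unfolding sum_distrib_left[symmetric] sum_distrib_right[symmetric] d
      by (simp add: power2_eq_square)
    also have "\<dots> \<le> 2"
      using square_le_two_power[of d]
      by (cases "d = 0") (auto simp: gain_def d_def[symmetric] divide_le_eq)
    finally show ?thesis .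
  qed
  have "(\<Sum>e\<in>U. \<Sum>f\<in>U. interaction R U e f)
      = (\<Sum>i\<in>I. prob R U i * (\<Sum>j\<in>J i. \<Sum>e\<in>U. \<Sum>f\<in>U.
           gain R U i j * of_bool (e \<in> P i j) * of_bool (f \<in> P i j)))"
    unfolding interaction_def sum.swap[of _ I] sum_distrib_left[symmetric] sum.swap[of _ "J _"] ..
  also have "\<dots> \<le> (\<Sum>i\<in>I. prob R U i * (2 * real (s\<^sup>2)))"
  proof (intro sum_mono mult_left_mono prob_nonneg)
    fix i assume i: "i \<in> I"
    have "(\<Sum>j\<in>J i. \<Sum>e\<in>U. \<Sum>f\<in>U. gain R U i j * of_bool (e \<in> P i j) * of_bool (f \<in> P i j))
        \<le> (\<Sum>j\<in>J i. 2)"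
      by (intro sum_mono block)
    also have "\<dots> \<le> 2 * real (s\<^sup>2)" using card_J[OF i] by (simp flip: of_nat_power)
    finally show "(\<Sum>j\<in>J i. \<Sum>e\<in>U. \<Sum>f\<in>U. gain R U i j * of_bool (e \<in> P i j) * of_bool (f \<in> P i j))
        \<le> 2 * real (s\<^sup>2)" .
  qed
  also have "\<dots> = 2 * real (s\<^sup>2) * pot R U"
    unfolding pot_def sum_distrib_right[symmetric] by (rule mult.commute)
  finally show ?thesis .
qed

text \<open>A crude bound for positions too small for averaging. It also covers
  \<open>e = f\<close>, which models the single edge of the final round.\<close>

lemma pot_update_le_double:
  assumes "finite U" "e \<in> U" "f \<in> U"
  shows "pot (insert e R) (U - {e, f}) \<le> 2 * pot R U"
  using pot_update[OF assms, of R] interaction_le_influence[of R U e f]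
    influence_le_pot[OF assms(1,2), of R] by linarith

lemma good_offer_exists:
  assumes fin: "finite U" and two: "card U \<ge> 2"
  shows "\<exists>e\<in>U. \<exists>f\<in>U. e \<noteq> f
    \<and> pot (insert e R) (U - {e, f}) \<le> pot R U * (1 + 8 * real s / real (card U))
    \<and> pot (insert f R) (U - {e, f}) \<le> pot R U * (1 + 8 * real s / real (card U))"
proof (cases "card U \<ge> 4 * (s + 1)")
  case True
  have "\<exists>e\<in>U. \<exists>f\<in>U. e \<noteq> f \<and> \<bar>influence R U e - influence R U f\<bar> + interaction R U e f
      \<le> pot R U * (8 * real s / real (card U))"
    by (rule close_pair_exists)
      (use fin True s_pos influence_nonneg influence_le_pot pot_nonneg interaction_nonneg
        sum_interaction_le in auto)
  then obtain e f where ef: "e \<in> U" "f \<in> U" "e \<noteq> f"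
    and le: "\<bar>influence R U e - influence R U f\<bar> + interaction R U e f
      \<le> pot R U * (8 * real s / real (card U))" by blast
  \<comment> \<open>The absolute difference and the symmetry of \<open>interaction\<close> let one
    estimate serve both choices of Client.\<close>
  have "pot (insert e R) (U - {e, f}) \<le> pot R U * (1 + 8 * real s / real (card U))"
    using pot_update[OF fin ef(1,2), of R] le unfolding distrib_left by linarith
  moreover have "pot (insert f R) (U - {e, f}) \<le> pot R U * (1 + 8 * real s / real (card U))"
    using pot_update[OF fin ef(2,1), of R] le interaction_commute[of R U e f]
    unfolding distrib_left insert_commute[of e f] by linarith
  ultimately show ?thesis using ef by blast
next
  case False
  obtain e f where ef: "e \<in> U" "f \<in> U" "e \<noteq> f"
    using two by (metis card_le_Suc0_iff_eq fin not_less_eq_eq numeral_2_eq_2)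
  have "real (card U) \<le> 8 * real s" using False s_pos by simp
  \<comment> \<open>Here the allowed factor is at least 2, so doubling is affordable with any two
    edges.\<close>
  then have "2 \<le> 1 + 8 * real s / real (card U)" using two by (simp add: field_simps)
  from mult_left_mono[OF this pot_nonneg[of R U]]
  have "2 * pot R U \<le> pot R U * (1 + 8 * real s / real (card U))" by simp
  then show ?thesis
    using pot_update_le_double[OF fin ef(1,2), of R] pot_update_le_double[OF fin ef(2,1), of R] ef
    unfolding insert_commute[of f e] by fastforce
qed

text \<open>Without free edges every \<open>prob\<close> is 0 or 1, so \<open>pot\<close> counts the
  \<open>i\<close> all of whose blocks contain a red edge.\<close>

lemma clean_block_exists_if_pot_less_one:
  assumes "pot R {} < 1" and i: "i \<in> I"
  shows "\<exists>j\<in>J i. P i j \<inter> R = {}"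
proof (rule ccontr)
  assume "\<not> ?thesis"
  then have "prob R {} i = 1" by (simp add: prob_def block_prob_def)
  moreover have "prob R {} i \<le> pot R {}"
    unfolding pot_def by (rule member_le_sum) (use i finite_I prob_nonneg in auto)
  ultimately show False using assms(1) by simp
qed

end

section \<open>Accumulated growth over the whole game\<close>

text \<open>Bernoulli's inequality for \<open>((M + 1) / (M - 1)) ^ c\<close>. With
  \<open>c = 8 * s\<close> it says that the weight \<open>(card U + 1) ^ c\<close> falls in a round
  by enough to pay for the growth of \<open>pot\<close>.\<close>

lemma growth_factor_le:
  assumes "M \<ge> 2"
  shows "(1 + real c / real M) * real (M - 1) ^ c \<le> real (M + 1) ^ c"
proof -
  have pos: "real (M - 1) > 0" using assms by simp
  have "1 + real c / real M \<le> 1 + real c * (2 / real (M - 1))"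
    using assms by (simp add: field_simps)
  also have "\<dots> \<le> (1 + 2 / real (M - 1)) ^ c"
    by (rule Bernoulli_inequality) (use pos in \<open>simp add: order.trans[of _ 0]\<close>)
  finally have "(1 + real c / real M) * real (M - 1) ^ c
      \<le> (1 + 2 / real (M - 1)) ^ c * real (M - 1) ^ c"
    by (rule mult_right_mono) simp
  also have "\<dots> = ((1 + 2 / real (M - 1)) * real (M - 1)) ^ c"
    by (simp only: power_mult_distrib)
  also have "(1 + 2 / real (M - 1)) * real (M - 1) = real (M + 1)"
    using assms by (simp add: field_simps)
  finally show ?thesis .
qed

text \<open>The invariant is that \<open>pot\<close> times the weight stays below 1; with no free
  edge left the weight is 1.\<close>

lemma waiter_wins_if_pot_small:
  fixes P :: "'i \<Rightarrow> 'j \<Rightarrow> nat set set"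
  assumes game: "block_game I J P s"
    and goal: "\<And>R. (\<And>i. i \<in> I \<Longrightarrow> \<exists>j\<in>J i. P i j \<inter> R = {}) \<Longrightarrow> \<not> contains_copy n T R"
    and "finite U" "block_game.pot I J P R U * real (card U + 1) ^ (8 * s) < 1"
  shows "waiter_wins_from n T R U"
  using assms(3,4)
proof (induction "card U" arbitrary: R U rule: less_induct)
  case less
  interpret block_game I J P s by (rule game)
  consider "card U = 0" | "card U = 1" | "card U \<ge> 2" by linarith
  then show ?case
  proof cases
    case 1
    then have "U = {}" using less.prems by simp
    then show ?thesis
      using less.prems
      by (intro waiter_wins_from.empty goal clean_block_exists_if_pot_less_one) auto
  next
    case 2
    then obtain e where U: "U = {e}" by (auto simp: card_1_singleton_iff)
    \<comment> \<open>With one free edge the weight is \<open>2 ^ (8 * s) \<ge> 2\<close>, which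
      pays for the doubling by that edge.\<close>
    have "(2::real) ^ 1 \<le> 2 ^ (8 * s)" using s_pos by (intro power_increasing) auto
    from mult_left_mono[OF this pot_nonneg[of R U]]
    have "2 * pot R U < 1" using less.prems(2) 2 by simp
    with pot_update_le_double[of U e e R] have "pot (insert e R) {} < 1" by (simp add: U)
    then show ?thesis
      by (intro waiter_wins_from.single[OF U] goal clean_block_exists_if_pot_less_one)
  next
    case 3
    obtain e f where ef: "e \<in> U" "f \<in> U" "e \<noteq> f"
      and le: "pot (insert e R) (U - {e, f}) \<le> pot R U * (1 + 8 * real s / real (card U))"
        "pot (insert f R) (U - {e, f}) \<le> pot R U * (1 + 8 * real s / real (card U))"
      using good_offer_exists[OF less.prems(1) 3] by blast
    have card: "card (U - {e, f}) = card U - 2"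
      using ef less.prems(1) by (simp add: card_Diff_subset)
    have step: "waiter_wins_from n T R' (U - {e, f})"
      if "pot R' (U - {e, f}) \<le> pot R U * (1 + 8 * real s / real (card U))" for R'
    proof (rule less.hyps)
      have eq: "card (U - {e, f}) + 1 = card U - 1" using card 3 by simp
      have "pot R' (U - {e, f}) * real (card (U - {e, f}) + 1) ^ (8 * s)
          \<le> pot R U * (1 + 8 * real s / real (card U)) * real (card U - 1) ^ (8 * s)"
        unfolding eq by (rule mult_right_mono[OF that]) simp
      also have "\<dots> \<le> pot R U * real (card U + 1) ^ (8 * s)"
        using mult_left_mono[OF growth_factor_le[OF 3, of "8 * s"] pot_nonneg[of R U]]
        by (simp add: mult.assoc)
      finally show "pot R' (U - {e, f}) * real (card (U - {e, f}) + 1) ^ (8 * s) < 1"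
        using less.prems(2) by simp
    qed (use card 3 less.prems in auto)
    show ?thesis
      by (rule waiter_wins_from.offer[OF ef step[OF le(1)] step[OF le(2)]])
  qed
qed

section \<open>Trees given by parent functions\<close>

definition parent_tree :: "(nat \<Rightarrow> nat) \<Rightarrow> nat \<Rightarrow> nat set set" where
  "parent_tree p n = {{v, p v} |v. 1 \<le> v \<and> v < n}"

lemma adj_commute: "adj E u v \<longleftrightarrow> adj E v u"
  by (auto simp: adj_def insert_commute)

lemma is_tree_parent_tree:
  assumes p: "\<And>v. v \<ge> 1 \<Longrightarrow> p v < v" and p0: "p 0 = 0" and "n \<ge> 1"
  shows "is_tree n (parent_tree p n)"
proof -
  let ?E = "parent_tree p n"
  have sub: "?E \<subseteq> Kn_edges n"
  proof
    fix e assume "e \<in> ?E"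
    then obtain v where v: "e = {v, p v}" "1 \<le> v" "v < n" by (auto simp: parent_tree_def)
    then have "v < n \<and> p v < n \<and> v \<noteq> p v \<and> e = {v, p v}" using p[of v] by simp
    then show "e \<in> Kn_edges n" unfolding Kn_edges_def by blast
  qed
  have root: "(adj ?E)\<^sup>*\<^sup>* v 0" if "v < n" for v
    using that
  proof (induction v rule: less_induct)
    case (less v)
    show ?case
    proof (cases "v = 0")
      case False
      then have pv: "p v < v" using p[of v] by simp
      then have "adj ?E v (p v)" using False less.prems by (auto simp: adj_def parent_tree_def)
      then show ?thesis using less.IH[OF pv] pv less.prems
        by (meson converse_rtranclp_into_rtranclp order.strict_trans)
    qed simp
  qed
  have "symp (adj ?E)" using adj_commute by (blast intro: sympI)
  then have "symp (adj ?E)\<^sup>*\<^sup>*" by (rule symp_rtranclp)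
  then have conn: "connected_on {0..<n} ?E"
    unfolding connected_on_def using root by (meson atLeastLessThan_iff rtranclp_trans sympD)
  have no_path: "\<not> (adj (?E - {{v, p v}}))\<^sup>*\<^sup>* v (p v)" if "v \<ge> 1" for v
  proof
    \<comment> \<open>\<open>D\<close> consists of \<open>v\<close> and its descendants; only the
      deleted edge \<open>{v, p v}\<close> leads out of it.\<close>
    define D where "D = {x. \<exists>i. (p ^^ i) x = v}"
    have D_step: "y \<in> D \<longleftrightarrow> p y \<in> D" if "y \<noteq> v" for y
    proof
      assume "y \<in> D"
      then obtain i where i: "(p ^^ i) y = v" by (auto simp: D_def)
      then obtain j where "i = Suc j" using \<open>y \<noteq> v\<close> by (cases i) auto
      then have "(p ^^ j) (p y) = v" using i by (simp add: funpow_swap1)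
      then show "p y \<in> D" by (auto simp: D_def)
    next
      assume "p y \<in> D"
      then obtain i where "(p ^^ i) (p y) = v" by (auto simp: D_def)
      then have "(p ^^ Suc i) y = v" by (simp add: funpow_swap1)
      then show "y \<in> D" unfolding D_def by blast
    qed
    have "p x \<le> x" for x using p[of x] p0 by (cases "x = 0") auto
    then have "(p ^^ i) (p v) \<le> p v" for i
      by (induction i) (auto intro: order.trans)
    then have "(p ^^ i) (p v) \<noteq> v" for i
      using p[OF that] by (metis not_less)
    then have "p v \<notin> D" by (simp add: D_def)
    assume "(adj (?E - {{v, p v}}))\<^sup>*\<^sup>* v (p v)"
    then have "p v \<in> D"
    proof (induction rule: rtranclp_induct)
      case base
      have "(p ^^ 0) v = v" by simp
      then show ?case unfolding D_def by blast
    next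
      case (step y z)
      then have "{y, z} \<in> ?E" "{y, z} \<noteq> {v, p v}" by (auto simp: adj_def)
      then obtain w where "{y, z} = {w, p w}" "w \<noteq> v" by (auto simp: parent_tree_def)
      then show ?case using D_step[of w] step.IH by (auto simp: doubleton_eq_iff)
    qed
    with \<open>p v \<notin> D\<close> show False by simp
  qed
  have "acyclic_graph ?E"
    unfolding acyclic_graph_def
  proof safe
    fix u v assume adj: "adj ?E u v" and path: "(adj (?E - {{u, v}}))\<^sup>*\<^sup>* u v"
    have "symp (adj (?E - {{u, v}}))" using adj_commute by (blast intro: sympI)
    then have path': "(adj (?E - {{u, v}}))\<^sup>*\<^sup>* v u"
      using path by (meson symp_rtranclp sympD)
    obtain w where w: "{u, v} = {w, p w}" "w \<ge> 1" using adj by (auto simp: adj_def parent_tree_def)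
    then consider "u = w" "v = p w" | "u = p w" "v = w" by (auto simp: doubleton_eq_iff)
    then show False
      using no_path[of w] path path' w(2) by cases (auto simp: insert_commute)
  qed
  with sub conn assms(3) show ?thesis by (simp add: is_tree_def)
qed

lemma degree_parent_tree_le:
  assumes fin: "finite {w. p w = v}"
  shows "degree (parent_tree p n) v \<le> card {w. p w = v} + 1"
proof -
  have "{e \<in> parent_tree p n. v \<in> e} \<subseteq> insert {v, p v} ((\<lambda>w. {w, p w}) ` {w. p w = v})"
    by (auto simp: parent_tree_def)
  then have "degree (parent_tree p n) v \<le> card (insert {v, p v} ((\<lambda>w. {w, p w}) ` {w. p w = v}))"
    unfolding degree_def by (rule card_mono[rotated]) (use fin in auto)
  also have "\<dots> \<le> Suc (card ((\<lambda>w. {w, p w}) ` {w. p w = v}))"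
    by (rule card_insert_le_m1) auto
  also have "\<dots> \<le> card {w. p w = v} + 1"
    using card_image_le[OF fin] by simp
  finally show ?thesis .
qed

text \<open>The image of \<open>{0..<k}\<close> dominates, because every other vertex of the tree
  has its parent in \<open>{0..<k}\<close>.\<close>

lemma copy_has_small_dominating_set:
  assumes copy: "contains_copy n (parent_tree p n) R"
    and p: "\<And>v. v < n \<Longrightarrow> p v < k" and k: "1 \<le> k" "k \<le> n"
  shows "\<exists>S\<subseteq>{0..<n}. card S = k \<and> (\<forall>v\<in>{0..<n} - S. \<exists>x\<in>S. {v, x} \<in> R)"
proof -
  obtain f where inj: "inj_on f {0..<n}" and into: "f ` {0..<n} \<subseteq> {0..<n}"
    and R: "\<forall>e\<in>parent_tree p n. f ` e \<in> R"
    using copy unfolding contains_copy_def by blast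
  \<comment> \<open>A spanning copy is a bijection, so every vertex outside \<open>S\<close> is the
    image of a tree vertex.\<close>
  have surj: "f ` {0..<n} = {0..<n}" using endo_inj_surj[OF _ into inj] by simp
  define S where "S = f ` {0..<k}"
  have "S \<subseteq> {0..<n}" using into k by (force simp: S_def)
  moreover have "card S = k"
    unfolding S_def using inj_on_subset[OF inj] k by (subst card_image) auto
  moreover have "\<exists>x\<in>S. {v, x} \<in> R" if v: "v \<in> {0..<n} - S" for v
  proof -
    obtain w where w: "w < n" "v = f w" using v surj by (metis DiffD1 atLeastLessThan_iff imageE)
    have "\<not> w < k" using w v by (auto simp: S_def)
    then have "{w, p w} \<in> parent_tree p n" using w k by (auto simp: parent_tree_def)
    then have "{v, f (p w)} \<in> R" using R w by force
    moreover have "f (p w) \<in> S" using p w by (auto simp: S_def)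
    ultimately show ?thesis by blast
  qed
  ultimately show ?thesis by blast
qed

section \<open>The block game on the complete graph\<close>

lemma finite_Kn_edges: "finite (Kn_edges n)"
  and card_Kn_edges_le: "card (Kn_edges n) \<le> n\<^sup>2"
proof -
  have sub: "Kn_edges n \<subseteq> (\<lambda>(u, v). {u, v}) ` ({0..<n} \<times> {0..<n})"
    by (auto simp: Kn_edges_def image_iff Bex_def)
  then show "finite (Kn_edges n)" by (rule finite_subset) auto
  have "card (Kn_edges n) \<le> card ({0..<n} \<times> {0..<n})"
    by (rule surj_card_le[OF _ sub]) auto
  then show "card (Kn_edges n) \<le> n\<^sup>2" by (simp add: power2_eq_square)
qed

lemma waiter_prevents_small_dominating_set:
  assumes k: "k \<le> n" and s: "s \<ge> 1" "n \<le> s\<^sup>2"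
    and goal: "\<And>R. contains_copy n T R \<Longrightarrow>
      \<exists>S\<subseteq>{0..<n}. card S = k \<and> (\<forall>v\<in>{0..<n} - S. \<exists>x\<in>S. {v, x} \<in> R)"
    and small: "real (n choose k) * (1 - (1/2) ^ k) ^ (n - k) * real (n\<^sup>2 + 1) ^ (8 * s) < 1"
  shows "waiter_wins_CW n T"
proof -
  define I where "I = {S. S \<subseteq> {0..<n} \<and> card S = k}"
  define J where "J S = {0..<n} - S" for S
  \<comment> \<open>The block of \<open>v\<close> is the star from \<open>v\<close> to
    \<open>S\<close>. As its centre lies outside \<open>S\<close>, stars of distinct centres are
    disjoint.\<close>
  define P where "P S v = (\<lambda>x. {v, x}) ` S" for S and v :: nat
  have card_outside: "card (J S) = n - k" if "S \<in> I" for S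
    using that finite_subset[of S "{0..<n}"] by (auto simp: I_def J_def card_Diff_subset)
  have game: "block_game I J P s"
  proof
    show "card (J i) \<le> s\<^sup>2" if "i \<in> I" for i using card_outside[OF that] s by simp
    show "j = j'" if "j \<in> J i" "j' \<in> J i" "x \<in> P i j" "x \<in> P i j'" for i j j' x
      using that by (auto simp: J_def P_def doubleton_eq_iff)
  qed (use s in \<open>auto simp: I_def J_def\<close>)
  interpret block_game I J P s by (rule game)
  have block: "block_prob {} (Kn_edges n) S v = 1 - (1/2) ^ k" if "S \<in> I" "v \<in> J S" for S v
  proof -
    have "{v, x} \<in> Kn_edges n" if "x \<in> S" for x
    proof -
      have "v < n \<and> x < n \<and> v \<noteq> x \<and> {v, x} = {v, x}"
        using that \<open>S \<in> I\<close> \<open>v \<in> J S\<close> unfolding I_def J_def by force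
      then show ?thesis unfolding Kn_edges_def by blast
    qed
    then have "P S v \<inter> Kn_edges n = P S v" by (auto simp: P_def)
    moreover have "card (P S v) = k"
      unfolding P_def using that
      by (subst card_image) (auto simp: I_def inj_on_def doubleton_eq_iff)
    ultimately show ?thesis by (simp add: block_prob_def)
  qed
  have "pot {} (Kn_edges n) = real (n choose k) * (1 - (1/2) ^ k) ^ (n - k)"
  proof -
    have "pot {} (Kn_edges n) = (\<Sum>S\<in>I. (1 - (1/2) ^ k) ^ (n - k))"
      unfolding pot_def prob_def by (intro sum.cong refl) (simp add: block card_outside)
    also have "\<dots> = real (card I) * (1 - (1/2) ^ k) ^ (n - k)" by simp
    also have "card I = n choose k" unfolding I_def by (simp add: n_subsets)
    finally show ?thesis .
  qed
  moreover have "real (card (Kn_edges n) + 1) ^ (8 * s) \<le> real (n\<^sup>2 + 1) ^ (8 * s)"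
    using card_Kn_edges_le[of n] by (intro power_mono) (auto simp flip: of_nat_power)
  ultimately have "pot {} (Kn_edges n) * real (card (Kn_edges n) + 1) ^ (8 * s) < 1"
    using small mult_left_mono[OF _ pot_nonneg[of "{}" "Kn_edges n"]] by fastforce
  moreover have "\<not> contains_copy n T R" if "\<And>i. i \<in> I \<Longrightarrow> \<exists>j\<in>J i. P i j \<inter> R = {}" for R
  proof
    assume "contains_copy n T R"
    then obtain S where S: "S \<in> I" "\<forall>v\<in>J S. \<exists>x\<in>S. {v, x} \<in> R"
      using goal unfolding I_def J_def by blast
    then show False using that[of S] by (auto simp: P_def)
  qed
  ultimately show ?thesis
    unfolding waiter_wins_CW_def using waiter_wins_if_pot_small[OF game] finite_Kn_edges by blast
qed

section \<open>Asymptotics and the final choice of the tree\<close>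

text \<open>Since \<open>1/2 \<ge> exp (-1)\<close>, taking \<open>k \<le> ln n / 4\<close> gives
  \<open>(1/2) ^ k \<ge> n powr (-1/4)\<close>. The resulting exponent of order
  \<open>n powr (3/4)\<close> beats both \<open>(ln n)\<^sup>2\<close> and
  \<open>sqrt n * ln n\<close>.\<close>

lemma initial_potential_small:
  "\<forall>\<^sub>F n :: nat in sequentially.
    real (n choose nat \<lfloor>ln (real n) / 4\<rfloor>)
      * (1 - (1/2) ^ nat \<lfloor>ln (real n) / 4\<rfloor>) ^ (n - nat \<lfloor>ln (real n) / 4\<rfloor>)
      * real (n\<^sup>2 + 1) ^ (8 * nat \<lceil>sqrt (real n)\<rceil>) < 1"
proof -
  have "\<forall>\<^sub>F n :: nat in sequentially.
      (ln (real n))\<^sup>2 / 4 + 24 * ln (real n) * (sqrt (real n) + 1)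
        < real n powr (3/4) / 2"
    by real_asymp
  moreover have "\<forall>\<^sub>F n :: nat in sequentially. ln (real n) / 4 \<le> real n / 2"
    by real_asymp
  ultimately show ?thesis
    using eventually_ge_at_top[of 2]
  proof eventually_elim
    case (elim n)
    define x where "x = real n"
    define k where "k = nat \<lfloor>ln (real n) / 4\<rfloor>"
    define s where "s = nat \<lceil>sqrt (real n)\<rceil>"
    have x: "x \<ge> 2" and ln_pos: "ln x > 0" using elim by (auto simp: x_def)
    have kx: "real k \<le> ln x / 4" using ln_pos unfolding k_def x_def by linarith
    have kn: "k \<le> n" and half: "real (n - k) \<ge> x / 2" using kx elim by (auto simp: x_def)
    have sx: "real s \<le> sqrt x + 1"
      using real_sqrt_ge_zero[of "real n"] unfolding s_def x_def by linarith
    have "real (n choose k) \<le> x ^ k"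
      using binomial_le_pow[OF kn] by (simp add: x_def flip: of_nat_power)
    also have "\<dots> = exp (real k * ln x)" using x by (simp add: exp_of_nat_mult)
    also have "\<dots> \<le> exp ((ln x)\<^sup>2 / 4)"
      using mult_right_mono[OF kx] ln_pos by (simp add: power2_eq_square)
    finally have b1: "real (n choose k) \<le> exp ((ln x)\<^sup>2 / 4)" .
    have "x powr (- (1/4)) \<le> exp (- real k)" using x kx by (simp add: powr_def)
    also have "\<dots> = (exp (-1)) ^ k" by (simp flip: exp_of_nat_mult)
    also have "\<dots> \<le> (1/2) ^ k"
      using exp_ge_add_one_self[of 1] by (intro power_mono) (auto simp: exp_minus field_simps)
    finally have "x powr (- (1/4)) * (x / 2) \<le> (1/2) ^ k * real (n - k)"
      using half x by (intro mult_mono) auto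
    moreover have "x powr (3/4) / 2 = x powr (- (1/4)) * (x / 2)"
      using x powr_add[of x "- (1/4)" 1] by simp
    ultimately have exponent: "x powr (3/4) / 2 \<le> (1/2) ^ k * real (n - k)" by simp
    have "(1 - (1/2) ^ k) ^ (n - k) \<le> exp (- ((1/2::real) ^ k)) ^ (n - k)"
      using exp_ge_add_one_self[of "- ((1/2::real) ^ k)"]
      by (intro power_mono) (auto simp: power_le_one)
    also have "\<dots> = exp (- ((1/2) ^ k * real (n - k)))"
      by (simp add: mult.commute flip: exp_of_nat_mult)
    also have "\<dots> \<le> exp (- (x powr (3/4) / 2))"
      using exponent by simp
    finally have b2: "(1 - (1/2) ^ k) ^ (n - k) \<le> exp (- (x powr (3/4) / 2))" .
    have "real (n\<^sup>2 + 1) \<le> x ^ 3"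
    proof -
      have "1 \<le> x\<^sup>2" using x by (simp add: one_le_power)
      then have "x\<^sup>2 + 1 \<le> 2 * x\<^sup>2" by simp
      also have "\<dots> \<le> x * x\<^sup>2" using x by (intro mult_right_mono) auto
      finally show ?thesis by (simp add: x_def power3_eq_cube power2_eq_square)
    qed
    also have "x ^ 3 = exp (3 * ln x)" using x exp_of_nat_mult[of 3 "ln x"] by simp
    finally have "real (n\<^sup>2 + 1) ^ (8 * s) \<le> exp (3 * ln x) ^ (8 * s)"
      by (intro power_mono) auto
    also have "\<dots> = exp (24 * ln x * real s)" by (simp add: mult_ac flip: exp_of_nat_mult)
    also have "\<dots> \<le> exp (24 * ln x * (sqrt x + 1))"
      using sx ln_pos by simp
    finally have b3: "real (n\<^sup>2 + 1) ^ (8 * s) \<le> exp (24 * ln x * (sqrt x + 1))" .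
    have "real (n choose k) * (1 - (1/2) ^ k) ^ (n - k) * real (n\<^sup>2 + 1) ^ (8 * s)
        \<le> exp ((ln x)\<^sup>2 / 4) * exp (- (x powr (3/4) / 2)) * exp (24 * ln x * (sqrt x + 1))"
      by (intro mult_mono b1 b2 b3 mult_nonneg_nonneg zero_le_power) (auto simp: power_le_one)
    also have "\<dots> = exp ((ln x)\<^sup>2 / 4 - x powr (3/4) / 2 + 24 * ln x * (sqrt x + 1))"
      by (simp flip: exp_add)
    also have "\<dots> < 1" using elim by (simp add: x_def)
    finally show ?case unfolding k_def s_def .
  qed
qed

theorem theorem1p4:
  shows "\<exists>c::real. c > 0 \<and> (\<exists>n0::nat. n0 > 0 \<and> (\<forall>n\<ge>n0. \<exists>T.
           is_tree n T \<and> (\<forall>v<n. real (degree T v) \<le> c * real n / ln (real n)) \<and>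
           waiter_wins_CW n T))"
proof -
  \<comment> \<open>From \<open>ln n \<ge> 8\<close> rounding down \<open>ln n / 4\<close> still
    leaves at least \<open>ln n / 8\<close>.\<close>
  have "\<forall>\<^sub>F n :: nat in sequentially. 8 \<le> ln (real n) \<and> ln (real n) / 4 \<le> real n - 1"
    by (intro eventually_conj; real_asymp)
  with initial_potential_small
  have "\<forall>\<^sub>F n :: nat in sequentially. \<exists>T. is_tree n T
      \<and> (\<forall>v<n. real (degree T v) \<le> 10 * real n / ln (real n)) \<and> waiter_wins_CW n T"
    using eventually_gt_at_top[of 0]
  proof eventually_elim
    case (elim n)
    define k where "k = nat \<lfloor>ln (real n) / 4\<rfloor>"
    define s where "s = nat \<lceil>sqrt (real n)\<rceil>"
    \<comment> \<open>The \<open>+ 1\<close> ensures \<open>n < k * m\<close>, so all parents lie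
      below \<open>k\<close>, and \<open>m \<ge> 2\<close>, so parents decrease.\<close>
    define m where "m = n div k + 1"
    define T where "T = parent_tree (\<lambda>v. v div m) n"
    have kx: "real k \<le> ln (real n) / 4" "ln (real n) / 8 \<le> real k"
      using elim unfolding k_def by linarith+
    have k: "1 \<le> k" "k \<le> n" using kx elim by linarith+
    have m: "m \<ge> 2" using k by (simp add: m_def div_greater_zero_iff Suc_le_eq)
    have s: "s \<ge> 1" "n \<le> s\<^sup>2"
    proof -
      have "sqrt (real n) \<le> real s" unfolding s_def by (rule real_nat_ceiling_ge)
      then have "real n \<le> (real s)\<^sup>2"
        by (metis real_sqrt_le_iff real_sqrt_pow2 of_nat_0_le_iff power_mono real_sqrt_ge_zero)
      then show "n \<le> s\<^sup>2" by (simp flip: of_nat_power)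
      then show "s \<ge> 1" using elim by (cases s) auto
    qed
    have "is_tree n T"
      unfolding T_def using m elim by (intro is_tree_parent_tree) auto
    \<comment> \<open>The 10 is 8 from \<open>k \<ge> ln n / 8\<close> plus 2 from absorbing the
      additive 2 via \<open>ln n \<le> n\<close>.\<close>
    moreover have "real (degree T v) \<le> 10 * real n / ln (real n)" for v
    proof -
      have children: "{w. w div m = v} = {v * m..<v * m + m}"
        using m by (auto simp: div_nat_eqI algebra_simps dividend_less_times_div)
      have "degree T v \<le> m + 1"
        unfolding T_def using degree_parent_tree_le[of "\<lambda>v. v div m" v n] by (simp add: children)
      then have "real (degree T v) \<le> real (n div k) + 2" by (simp add: m_def)
      also have "real (n div k) \<le> real n / real k" by (rule of_nat_div_le_of_nat)
      also have "\<dots> \<le> real n / (ln (real n) / 8)"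
        using kx elim by (intro divide_left_mono) auto
      also have "2 \<le> 2 * (real n / ln (real n))"
        using elim ln_le_minus_one[of "real n"] by (simp add: field_simps)
      finally show ?thesis by simp
    qed
    moreover have "waiter_wins_CW n T"
    proof (rule waiter_prevents_small_dominating_set[OF k(2) s])
      have "v div m < k" if "v < n" for v
      proof -
        have "n < k * m" using k by (simp add: m_def dividend_less_times_div)
        then show ?thesis using that m by (simp add: div_less_iff_less_mult)
      qed
      then show "\<exists>S\<subseteq>{0..<n}. card S = k \<and> (\<forall>v\<in>{0..<n} - S. \<exists>x\<in>S. {v, x} \<in> R)"
        if "contains_copy n T R" for R
        using copy_has_small_dominating_set that k unfolding T_def by blast
    qed (use elim in \<open>simp add: k_def s_def\<close>)
    ultimately show ?case by blast
  qed
  then obtain n0 where n0: "\<forall>n\<ge>n0. \<exists>T. is_tree n T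
      \<and> (\<forall>v<n. real (degree T v) \<le> 10 * real n / ln (real n)) \<and> waiter_wins_CW n T"
    by (auto simp: eventually_at_top_linorder)
  show ?thesis
    by (intro exI[of _ 10] conjI exI[of _ "Suc n0"]) (use n0 in auto)
qed

end
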